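(* There is an absolute constant $C>0$ such that the following holds. Let $n,c\ge 1$ be integers and let $f:\{0,1\}^n\times\{0,1\}^n\to\{0,1\}$ be a Boolean function. If $f$ has a classical public-coin simultaneous message passing protocol with worst-case error probability at most $1/3$ in which Alice's and Bob's messages have $c$ bits each, then $f$ has a quantum simultaneous message passing protocol, without public coin and without shared entanglement, with worst-case error probability at most $1/3$, using at most $C\cdot 2^{2c}(c+\log n)$ qubits of communication.
   Context: Simultaneous message passing (SMP) model: Alice gets $x\in\{0,1\}^n$, Bob gets $y\in\{0,1\}^n$; each sends a single message to a referee, who outputs a bit that should equal $f(x,y)$. The cost is the total message length for a worst-case input. In a classical public-coin protocol the messages are bit strings and Alice and Bob share a random string (the referee's output depends only on the two messages, not on the shared string). In a quantum protocol without public coin, Alice and Bob send quantum states depending only on their own inputs (the joint state is a tensor product), and the referee obtains his output by measuring the joint state. *)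

theory Defs
  imports
    "HOL-Probability.Probability_Mass_Function"
    "Jordan_Normal_Form.Matrix"
begin

definition bitstrings :: "nat \<Rightarrow> bool list set" where
  "bitstrings n = {s. length s = n}"


section \<open>Classical public-coin simultaneous message passing\<close>

text \<open>
  The shared random string is drawn from an arbitrary distribution \<open>R\<close> on finite bit strings.
  This includes the uniform distribution on strings of any fixed length, and private coins of
  Alice and Bob can be taken to be part of the shared string.
  The referee does not see the shared string. His output is given as a distribution that depends
  on the two messages only; a deterministic referee is the case of point distributions.
\<close>

definition public_coin_output ::
  "bool list pmf \<Rightarrow> (bool list \<Rightarrow> bool list \<Rightarrow> bool list) \<Rightarrow> (bool list \<Rightarrow> bool list \<Rightarrow> bool list) \<Rightarrow>
   (bool list \<Rightarrow> bool list \<Rightarrow> bool pmf) \<Rightarrow> bool list \<Rightarrow> bool list \<Rightarrow> bool pmf" where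
  "public_coin_output R alice bob referee x y =
     bind_pmf R (\<lambda>r. referee (alice r x) (bob r y))"

definition has_public_coin_SMP_protocol ::
  "nat \<Rightarrow> (bool list \<Rightarrow> bool list \<Rightarrow> bool) \<Rightarrow> real \<Rightarrow> nat \<Rightarrow> bool" where
  "has_public_coin_SMP_protocol n f \<epsilon> c \<longleftrightarrow>
     (\<exists>R alice bob referee.
        (\<forall>r \<in> set_pmf R. \<forall>x \<in> bitstrings n. alice r x \<in> bitstrings c) \<and>
        (\<forall>r \<in> set_pmf R. \<forall>y \<in> bitstrings n. bob r y \<in> bitstrings c) \<and>
        (\<forall>x \<in> bitstrings n. \<forall>y \<in> bitstrings n.
           measure_pmf.prob (public_coin_output R alice bob referee x y) {z. z \<noteq> f x y} \<le> \<epsilon>))"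


section \<open>Quantum states and measurements\<close>

definition mat_trace :: "complex mat \<Rightarrow> complex" where
  "mat_trace A = (\<Sum>i<dim_row A. A $$ (i, i))"

text \<open>Kronecker product; the index of the pair \<open>(i, k)\<close> is \<open>i * dim_row B + k\<close>, likewise for columns.\<close>

definition tensor_mat :: "complex mat \<Rightarrow> complex mat \<Rightarrow> complex mat" where
  "tensor_mat A B = mat (dim_row A * dim_row B) (dim_col A * dim_col B)
     (\<lambda>(i, j). A $$ (i div dim_row B, j div dim_col B) * B $$ (i mod dim_row B, j mod dim_col B))"

text \<open>
  The order on \<^typ>\<open>complex\<close> is that of \<^theory>\<open>HOL-Library.Complex_Order\<close>: \<open>0 \<le> z\<close> says that \<open>z\<close> is real
  and nonnegative, so a matrix that is positive semidefinite in this sense is Hermitian.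
\<close>

definition psd_mat :: "nat \<Rightarrow> complex mat \<Rightarrow> bool" where
  "psd_mat d A \<longleftrightarrow> A \<in> carrier_mat d d \<and> (\<forall>v \<in> carrier_vec d. 0 \<le> (A *\<^sub>v v) \<bullet>c v)"

text \<open>States may be mixed; a pure state is a density matrix of rank one.\<close>

definition qubit_state :: "nat \<Rightarrow> complex mat \<Rightarrow> bool" where
  "qubit_state q \<rho> \<longleftrightarrow> psd_mat (2 ^ q) \<rho> \<and> mat_trace \<rho> = 1"

definition binary_POVM :: "nat \<Rightarrow> (bool \<Rightarrow> complex mat) \<Rightarrow> bool" where
  "binary_POVM q E \<longleftrightarrow>
     psd_mat (2 ^ q) (E False) \<and> psd_mat (2 ^ q) (E True) \<and> E False + E True = 1\<^sub>m (2 ^ q)"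

definition outcome_prob :: "(bool \<Rightarrow> complex mat) \<Rightarrow> complex mat \<Rightarrow> bool \<Rightarrow> real" where
  "outcome_prob E \<rho> z = Re (mat_trace (E z * \<rho>))"


section \<open>Quantum simultaneous message passing\<close>

text \<open>Alice sends \<open>a\<close> qubits and Bob sends \<open>b\<close> qubits.\<close>

definition has_quantum_SMP_protocol ::
  "nat \<Rightarrow> (bool list \<Rightarrow> bool list \<Rightarrow> bool) \<Rightarrow> real \<Rightarrow> nat \<Rightarrow> nat \<Rightarrow> bool" where
  "has_quantum_SMP_protocol n f \<epsilon> a b \<longleftrightarrow>
     (\<exists>alice bob E.
        (\<forall>x \<in> bitstrings n. qubit_state a (alice x)) \<and>
        (\<forall>y \<in> bitstrings n. qubit_state b (bob y)) \<and>
        binary_POVM (a + b) E \<and>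
        (\<forall>x \<in> bitstrings n. \<forall>y \<in> bitstrings n.
           outcome_prob E (tensor_mat (alice x) (bob y)) (\<not> f x y) \<le> \<epsilon>))"

end

(*
  The public coin is first replaced by a uniform choice among t = O(n) sampled random strings.
  If the referee accepts the messages s, s' with probability M s s', Alice and Bob can prepare
  states of O(c + log n) qubits whose inner product is the average of M (a r x) (b r y) over the
  samples r, scaled by 1 / sqrt (2 ^ c). The swap test estimates the square of this inner product.
  Its acceptance probabilities for the two values of f differ by a constant times 1 / 2 ^ c, so
  O(2 ^ (2 c)) independent repetitions with a threshold on the number of acceptances suffice.
*)

theory Submission
  imports Defs
begin

unbundle no vec_syntax

section \<open>Protocols from real amplitudes\<close>

text \<open>A register in superposition stands in for the shared string, so its number of values
  must be small: with \<open>t\<close> linear in \<open>n\<close> it costs only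
  \<open>log n + O(1)\<close> qubits, whereas the original distribution may have any support.
  Neither party knows the other's message, so neither can encode \<open>M s s'\<close> alone.
  Alice's amplitude selects her actual message, while Bob's amplitudes list the referee's answer to
  every message that she might send. Her weight sits on one of \<open>2 ^ c\<close> candidates and
  his is spread evenly over all of them, which is exactly the loss of
  \<open>1 / sqrt (2 ^ c)\<close>. Squaring the inner product makes the gap of order
  \<open>1 / 2 ^ c\<close>. It also forgets the sign, which is harmless because averages of
  acceptance probabilities are nonnegative. The exponent in the Chernoff bound is quadratic in the
  gap, hence the factor \<open>2 ^ (2 * c)\<close> in the cost. All amplitudes are real and all
  measurements are families of real vectors, so once the Born rule is available the argument
  concerns only finite sums of real numbers.\<close>

definition gram_mat :: "nat \<Rightarrow> 's set \<Rightarrow> ('s \<Rightarrow> nat \<Rightarrow> real) \<Rightarrow> complex mat" where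
  "gram_mat d S L = mat d d (\<lambda>(i, j). complex_of_real (\<Sum>s\<in>S. L s i * L s j))"

lemma gram_mat_carrier [simp]: "gram_mat d S L \<in> carrier_mat d d"
  by (simp add: gram_mat_def)

text \<open>\<open>gram_mat\<close> is the sum over \<open>s\<close> of the rank-one operators of
  the real vectors \<open>L s\<close>, so its quadratic form at \<open>v\<close> is the sum of the
  squared moduli of the inner products of \<open>v\<close> with the \<open>L s\<close>. This serves
  both for measurement operators and, with a one-element index set, for pure states.\<close>

lemma psd_gram_mat: "psd_mat d (gram_mat d S L)"
  unfolding psd_mat_def
proof (intro conjI ballI)
  fix v :: "complex vec" assume v: "v \<in> carrier_vec d"
  define T where "T s = (\<Sum>j<d. of_real (L s j) * v $ j)" for s
  have "(gram_mat d S L *\<^sub>v v) \<bullet>c v =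
        (\<Sum>i<d. (\<Sum>j<d. (\<Sum>s\<in>S. of_real (L s i) * of_real (L s j)) * v $ j) * cnj (v $ i))"
    using v by (simp add: gram_mat_def scalar_prod_def lessThan_atLeast0)
  also have "\<dots> = (\<Sum>i<d. \<Sum>j<d. \<Sum>s\<in>S. (of_real (L s j) * v $ j) * cnj (of_real (L s i) * v $ i))"
    by (simp add: sum_distrib_left sum_distrib_right algebra_simps)
  also have "\<dots> = (\<Sum>i<d. \<Sum>s\<in>S. \<Sum>j<d. (of_real (L s j) * v $ j) * cnj (of_real (L s i) * v $ i))"
    by (intro sum.cong refl sum.swap)
  also have "\<dots> = (\<Sum>s\<in>S. \<Sum>i<d. \<Sum>j<d. (of_real (L s j) * v $ j) * cnj (of_real (L s i) * v $ i))"
    by (rule sum.swap)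
  also have "\<dots> = (\<Sum>s\<in>S. T s * cnj (T s))"
  proof (intro sum.cong refl)
    fix s
    have "T s * cnj (T s) = (\<Sum>j<d. \<Sum>i<d. (of_real (L s j) * v $ j) * cnj (of_real (L s i) * v $ i))"
      unfolding T_def cnj_sum by (rule sum_product)
    then show "(\<Sum>i<d. \<Sum>j<d. (of_real (L s j) * v $ j) * cnj (of_real (L s i) * v $ i)) = T s * cnj (T s)"
      using sum.swap[of "\<lambda>i j. (of_real (L s j) * v $ j) * cnj (of_real (L s i) * v $ i)" "{..<d}" "{..<d}"]
      by simp
  qed
  also have "\<dots> = of_real (\<Sum>s\<in>S. (cmod (T s))\<^sup>2)"
    by (simp flip: complex_norm_square)
  also have "0 \<le> \<dots>"
    by (simp add: less_eq_complex_def sum_nonneg)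
  finally show "0 \<le> (gram_mat d S L *\<^sub>v v) \<bullet>c v" .
qed simp

text \<open>This is the Born rule: against the rank-one operator of \<open>v\<close>, each
  \<open>L s\<close> contributes the square of its amplitude.\<close>

lemma trace_gram_mat_mult_rank1:
  "mat_trace (gram_mat d S L * gram_mat d {()} (\<lambda>_. v)) = of_real (\<Sum>s\<in>S. (\<Sum>i<d. L s i * v i)\<^sup>2)"
proof -
  have "mat_trace (gram_mat d S L * gram_mat d {()} (\<lambda>_. v)) =
        of_real (\<Sum>i<d. \<Sum>j<d. (\<Sum>s\<in>S. L s i * L s j) * (v j * v i))"
    by (simp add: mat_trace_def gram_mat_def scalar_prod_def lessThan_atLeast0)
  also have "(\<Sum>i<d. \<Sum>j<d. (\<Sum>s\<in>S. L s i * L s j) * (v j * v i)) =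
             (\<Sum>i<d. \<Sum>j<d. \<Sum>s\<in>S. (L s i * v i) * (L s j * v j))"
    by (simp add: sum_distrib_left sum_distrib_right algebra_simps)
  also have "\<dots> = (\<Sum>i<d. \<Sum>s\<in>S. \<Sum>j<d. (L s i * v i) * (L s j * v j))"
    by (intro sum.cong refl sum.swap)
  also have "\<dots> = (\<Sum>s\<in>S. \<Sum>i<d. \<Sum>j<d. (L s i * v i) * (L s j * v j))"
    by (rule sum.swap)
  also have "\<dots> = (\<Sum>s\<in>S. (\<Sum>i<d. L s i * v i)\<^sup>2)"
    by (simp add: power2_eq_square sum_product)
  finally show ?thesis .
qed

lemma qubit_state_gram_mat:
  assumes "(\<Sum>i<2 ^ q. (v i)\<^sup>2) = 1"
  shows "qubit_state q (gram_mat (2 ^ q) {()} (\<lambda>_. v))"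
proof -
  have "mat_trace (gram_mat (2 ^ q) {()} (\<lambda>_. v)) = of_real (\<Sum>i<2 ^ q. (v i)\<^sup>2)"
    by (simp add: mat_trace_def gram_mat_def power2_eq_square)
  with assms show ?thesis
    by (simp add: qubit_state_def psd_gram_mat)
qed

lemma tensor_gram_mat_rank1:
  "tensor_mat (gram_mat d {()} (\<lambda>_. u)) (gram_mat e {()} (\<lambda>_. w)) =
   gram_mat (d * e) {()} (\<lambda>_ i. u (i div e) * w (i mod e))"
proof (cases "e = 0")
  case False
  have "i div e < d" if "i < d * e" for i
    using that by (simp add: less_mult_imp_div_less)
  with False show ?thesis
    by (intro eq_matI) (auto simp: tensor_mat_def gram_mat_def)
qed (auto simp: tensor_mat_def gram_mat_def)

lemma sum_div_mod:
  fixes F :: "nat \<Rightarrow> nat \<Rightarrow> 'a::comm_monoid_add"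
  shows "(\<Sum>k<d * e. F (k div e) (k mod e)) = (\<Sum>i<d. \<Sum>j<e. F i j)"
proof (cases "e = 0")
  case False
  have "i * e + j < d * e" if "i < d" "j < e" for i j
  proof -
    have "i * e + j < Suc i * e" using that by simp
    also have "\<dots> \<le> d * e" using that by (intro mult_le_mono1) simp
    finally show ?thesis .
  qed
  then have "(\<Sum>k<d * e. F (k div e) (k mod e)) = (\<Sum>(i, j)\<in>{..<d} \<times> {..<e}. F i j)"
    using False
    by (intro sum.reindex_bij_witness[of _ "\<lambda>(i, j). i * e + j" "\<lambda>k. (k div e, k mod e)"])
       (auto simp: less_mult_imp_div_less)
  then show ?thesis by (simp add: sum.cartesian_product)
qed simp

text \<open>Hides matrices and flattened indices from everything that follows: \<open>A\<close> and
  \<open>B\<close> may be any index sets of the right size, and \<open>acc\<close> is classical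
  postprocessing of the outcome \<open>s\<close>. The condition \<open>parseval\<close> is the
  completeness relation of the measurement. It permits overcomplete families such as the swap
  vectors, of which there are twice as many as the dimension.\<close>

lemma quantum_SMP_protocol_of_amplitudes:
  fixes L :: "'s \<Rightarrow> 'a \<Rightarrow> 'b \<Rightarrow> real"
  assumes A: "card A = 2 ^ a" and B: "card B = 2 ^ b" and S: "finite S"
    and parseval: "\<And>i i' j j'. i \<in> A \<Longrightarrow> i' \<in> A \<Longrightarrow> j \<in> B \<Longrightarrow> j' \<in> B \<Longrightarrow>
        (\<Sum>s\<in>S. L s i j * L s i' j') = of_bool (i = i' \<and> j = j')"
    and u: "\<And>x. x \<in> bitstrings n \<Longrightarrow> (\<Sum>i\<in>A. (u x i)\<^sup>2) = 1"
    and w: "\<And>y. y \<in> bitstrings n \<Longrightarrow> (\<Sum>j\<in>B. (w y j)\<^sup>2) = 1"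
    and err: "\<And>x y. x \<in> bitstrings n \<Longrightarrow> y \<in> bitstrings n \<Longrightarrow>
        (\<Sum>s | s \<in> S \<and> acc s \<noteq> f x y. (\<Sum>i\<in>A. \<Sum>j\<in>B. L s i j * (u x i * w y j))\<^sup>2) \<le> \<epsilon>"
  shows "has_quantum_SMP_protocol n f \<epsilon> a b"
proof -
  have "finite A" "finite B" using A B by (auto intro: card_ge_0_finite)
  then obtain g h where g: "bij_betw g {..<(2::nat) ^ a} A" and h: "bij_betw h {..<(2::nat) ^ b} B"
    using ex_bij_betw_nat_finite[of A] ex_bij_betw_nat_finite[of B] A B
    by (metis lessThan_atLeast0)
  define alice where "alice x = gram_mat (2 ^ a) {()} (\<lambda>_. u x \<circ> g)" for x
  define bob where "bob y = gram_mat (2 ^ b) {()} (\<lambda>_. w y \<circ> h)" for y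
  \<comment> \<open>Quotient and remainder follow the index convention of \<open>tensor_mat\<close>,
    with Alice's index as the high part.\<close>
  define K where "K s k = L s (g (k div 2 ^ b)) (h (k mod 2 ^ b))" for s k
  define E where "E z = gram_mat (2 ^ (a + b)) {s \<in> S. acc s = z} K" for z
  have "qubit_state a (alice x)" if "x \<in> bitstrings n" for x
    unfolding alice_def using u[OF that] sum.reindex_bij_betw[OF g, of "\<lambda>i. (u x i)\<^sup>2"]
    by (intro qubit_state_gram_mat) simp
  moreover have "qubit_state b (bob y)" if "y \<in> bitstrings n" for y
    unfolding bob_def using w[OF that] sum.reindex_bij_betw[OF h, of "\<lambda>i. (w y i)\<^sup>2"]
    by (intro qubit_state_gram_mat) simp
  moreover have "binary_POVM (a + b) E"
  proof -
    have "(\<Sum>s | s \<in> S \<and> \<not> acc s. K s k * K s k') + (\<Sum>s | s \<in> S \<and> acc s. K s k * K s k')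
          = of_bool (k = k')" if "k < 2 ^ (a + b)" "k' < 2 ^ (a + b)" for k k'
    proof -
      have lt: "k div 2 ^ b < 2 ^ a" "k' div 2 ^ b < 2 ^ a" "k mod 2 ^ b < 2 ^ b" "k' mod 2 ^ b < 2 ^ b"
        using that by (simp_all add: less_mult_imp_div_less power_add)
      have "(\<Sum>s | s \<in> S \<and> \<not> acc s. K s k * K s k') + (\<Sum>s | s \<in> S \<and> acc s. K s k * K s k')
            = (\<Sum>s\<in>S. K s k * K s k')"
        using S by (subst sum.union_disjoint[symmetric]) (auto intro: sum.cong)
      also have "\<dots> = of_bool (g (k div 2 ^ b) = g (k' div 2 ^ b) \<and> h (k mod 2 ^ b) = h (k' mod 2 ^ b))"
        unfolding K_def using lt bij_betwE[OF g] bij_betwE[OF h] by (intro parseval) auto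
      also have "\<dots> = of_bool (k div 2 ^ b = k' div 2 ^ b \<and> k mod 2 ^ b = k' mod 2 ^ b)"
        using lt inj_on_eq_iff[OF bij_betw_imp_inj_on[OF g]] inj_on_eq_iff[OF bij_betw_imp_inj_on[OF h]]
        by simp
      also have "\<dots> = of_bool (k = k')"
        using div_mult_mod_eq[of k "2 ^ b"] div_mult_mod_eq[of k' "2 ^ b"]
        by (intro arg_cong[where f = of_bool]) metis
      finally show ?thesis .
    qed
    then have "E False + E True = 1\<^sub>m (2 ^ (a + b))"
      unfolding E_def gram_mat_def
      by (intro eq_matI) (auto simp del: of_real_sum simp flip: of_real_add)
    then show ?thesis
      by (simp add: binary_POVM_def E_def psd_gram_mat)
  qed
  moreover have "outcome_prob E (tensor_mat (alice x) (bob y)) (\<not> f x y) \<le> \<epsilon>"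
    if x: "x \<in> bitstrings n" and y: "y \<in> bitstrings n" for x y
  proof -
    have "(\<Sum>k<2 ^ (a + b). K s k * (u x (g (k div 2 ^ b)) * w y (h (k mod 2 ^ b))))
          = (\<Sum>i\<in>A. \<Sum>j\<in>B. L s i j * (u x i * w y j))" for s
    proof -
      have "(\<Sum>k<2 ^ (a + b). K s k * (u x (g (k div 2 ^ b)) * w y (h (k mod 2 ^ b))))
            = (\<Sum>i<2 ^ a. \<Sum>j<2 ^ b. L s (g i) (h j) * (u x (g i) * w y (h j)))"
        unfolding K_def power_add
        by (rule sum_div_mod[of "\<lambda>i j. L s (g i) (h j) * (u x (g i) * w y (h j))"])
      also have "\<dots> = (\<Sum>i<2 ^ a. \<Sum>j\<in>B. L s (g i) j * (u x (g i) * w y j))"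
        by (intro sum.cong refl sum.reindex_bij_betw[OF h])
      also have "\<dots> = (\<Sum>i\<in>A. \<Sum>j\<in>B. L s i j * (u x i * w y j))"
        by (rule sum.reindex_bij_betw[OF g])
      finally show ?thesis .
    qed
    then have "outcome_prob E (tensor_mat (alice x) (bob y)) (\<not> f x y) =
      (\<Sum>s | s \<in> S \<and> acc s = (\<not> f x y). (\<Sum>i\<in>A. \<Sum>j\<in>B. L s i j * (u x i * w y j))\<^sup>2)"
      unfolding outcome_prob_def alice_def bob_def tensor_gram_mat_rank1
      by (simp add: E_def trace_gram_mat_mult_rank1 flip: power_add)
    also have "{s. s \<in> S \<and> acc s = (\<not> f x y)} = {s. s \<in> S \<and> acc s \<noteq> f x y}" by auto
    finally show ?thesis using err[OF x y] by simp
  qed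
  ultimately show ?thesis
    unfolding has_quantum_SMP_protocol_def by blast
qed

section \<open>Exponential moment bounds\<close>

lemma exp_le_one_plus_self_plus_square:
  fixes y :: real
  assumes "\<bar>y\<bar> \<le> 1"
  shows "exp y \<le> 1 + y + y\<^sup>2"
proof (cases "0 \<le> y")
  case True
  then show ?thesis using assms by (intro exp_bound) auto
next
  case False
  \<comment> \<open>The product telescopes to \<open>1 - y ^ 3\<close>, and \<open>y\<close> is
    negative here.\<close>
  then have "1 \<le> (1 + y + y\<^sup>2) * (1 - y)"
    by (simp add: algebra_simps power2_eq_square mult_nonneg_nonpos2)
  also have "\<dots> \<le> (1 + y + y\<^sup>2) * exp (- y)"
    using assms exp_ge_add_one_self[of "- y"] by (intro mult_left_mono) auto
  finally show ?thesis
    by (simp add: exp_minus field_simps)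
qed

text \<open>Markov's inequality for the exponential of \<open>r\<close> times the sum: the product
  weights make the moment a \<open>k\<close>-th power, and each factor is at most
  \<open>1 + r\<^sup>2 - r * d\<close>. The choice \<open>r = d / 2\<close> minimises this to
  \<open>1 - d\<^sup>2 / 4\<close>.\<close>

lemma product_Chernoff_bound:
  fixes P Y :: "'s \<Rightarrow> real" and k :: nat
  assumes S: "finite S" and P: "\<And>s. s \<in> S \<Longrightarrow> 0 \<le> P s" "(\<Sum>s\<in>S. P s) = 1"
    and Y: "\<And>s. s \<in> S \<Longrightarrow> \<bar>Y s\<bar> \<le> 1" and mean: "(\<Sum>s\<in>S. P s * Y s) \<le> - d"
    and d: "0 \<le> d" "d \<le> 1"
  shows "(\<Sum>s | s \<in> {..<k} \<rightarrow>\<^sub>E S \<and> 0 \<le> (\<Sum>l<k. Y (s l)). \<Prod>l<k. P (s l)) \<le> exp (- (d\<^sup>2 * k / 4))"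
proof -
  define r where "r = d / 2"
  have fin: "finite ({..<k} \<rightarrow>\<^sub>E S)" using S by (intro finite_PiE) auto
  have nonneg: "0 \<le> (\<Prod>l<k. P (s l))" if "s \<in> {..<k} \<rightarrow>\<^sub>E S" for s
    using that by (intro prod_nonneg) (auto intro!: P(1))
  have "(\<Sum>s | s \<in> {..<k} \<rightarrow>\<^sub>E S \<and> 0 \<le> (\<Sum>l<k. Y (s l)). \<Prod>l<k. P (s l))
        \<le> (\<Sum>s | s \<in> {..<k} \<rightarrow>\<^sub>E S \<and> 0 \<le> (\<Sum>l<k. Y (s l)). (\<Prod>l<k. P (s l)) * exp (r * (\<Sum>l<k. Y (s l))))"
  proof (intro sum_mono)
    fix s assume s: "s \<in> {s. s \<in> {..<k} \<rightarrow>\<^sub>E S \<and> 0 \<le> (\<Sum>l<k. Y (s l))}"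
    have "1 \<le> exp (r * (\<Sum>l<k. Y (s l)))" using s d by (simp add: r_def)
    from mult_left_mono[OF this nonneg] s
    show "(\<Prod>l<k. P (s l)) \<le> (\<Prod>l<k. P (s l)) * exp (r * (\<Sum>l<k. Y (s l)))" by simp
  qed
  also have "\<dots> \<le> (\<Sum>s\<in>{..<k} \<rightarrow>\<^sub>E S. (\<Prod>l<k. P (s l)) * exp (r * (\<Sum>l<k. Y (s l))))"
    using nonneg by (intro sum_mono2 fin) auto
  also have "\<dots> = (\<Sum>s\<in>{..<k} \<rightarrow>\<^sub>E S. \<Prod>l<k. P (s l) * exp (r * Y (s l)))"
    by (simp add: prod.distrib exp_sum sum_distrib_left)
  also have "\<dots> = (\<Sum>s\<in>S. P s * exp (r * Y s)) ^ k"
    using S by (subst prod_sum_PiE[symmetric]) auto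
  also have "\<dots> \<le> (exp (- (d\<^sup>2 / 4))) ^ k"
  proof (intro power_mono sum_nonneg)
    have "(\<Sum>s\<in>S. P s * exp (r * Y s)) \<le> (\<Sum>s\<in>S. P s * (1 + r\<^sup>2) + r * (P s * Y s))"
    proof (intro sum_mono)
      fix s assume s: "s \<in> S"
      have "\<bar>r * Y s\<bar> \<le> 1"
        unfolding abs_mult using d Y[OF s] by (intro mult_le_one) (auto simp: r_def)
      then have "exp (r * Y s) \<le> 1 + r * Y s + r\<^sup>2 * (Y s)\<^sup>2"
        using exp_le_one_plus_self_plus_square by (fastforce simp: power_mult_distrib)
      also have "\<dots> \<le> 1 + r * Y s + r\<^sup>2 * 1"
        using Y[OF s] by (intro add_left_mono mult_left_mono) (auto simp: abs_square_le_1)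
      finally have "exp (r * Y s) \<le> 1 + r\<^sup>2 + r * Y s" by simp
      from mult_left_mono[OF this P(1)[OF s]]
      show "P s * exp (r * Y s) \<le> P s * (1 + r\<^sup>2) + r * (P s * Y s)"
        by (simp add: algebra_simps)
    qed
    also have "\<dots> = (1 + r\<^sup>2) + r * (\<Sum>s\<in>S. P s * Y s)"
      using P(2) by (simp add: sum.distrib flip: sum_distrib_left sum_distrib_right)
    also have "\<dots> \<le> (1 + r\<^sup>2) + r * (- d)"
      using mean d by (intro add_left_mono mult_left_mono) (auto simp: r_def)
    also have "\<dots> = 1 + - (d\<^sup>2 / 4)" by (simp add: r_def power2_eq_square field_simps)
    also have "\<dots> \<le> exp (- (d\<^sup>2 / 4))" by (rule exp_ge_add_one_self)
    finally show "(\<Sum>s\<in>S. P s * exp (r * Y s)) \<le> exp (- (d\<^sup>2 / 4))" .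
  qed (use P in auto)
  also have "\<dots> = exp (- (d\<^sup>2 * k / 4))"
    by (simp add: exp_of_nat_mult[symmetric] mult.commute)
  finally show ?thesis .
qed

lemma pmf_exists_le_expectation:
  fixes F :: "'r \<Rightarrow> real"
  assumes F: "integrable (measure_pmf R) F" "measure_pmf.expectation R F \<le> K"
  obtains r where "r \<in> set_pmf R" "F r \<le> K"
proof -
  have "\<exists>r\<in>set_pmf R. F r \<le> K"
  proof (rule ccontr)
    assume "\<not> ?thesis"
    then have "AE r in measure_pmf R. K < F r" by (auto simp: AE_measure_pmf_iff)
    then have "K < measure_pmf.expectation R F"
      by (intro measure_pmf.expectation_greater F) auto
    with F show False by simp
  qed
  with that show thesis by blast
qed

text \<open>
  The sample is chosen greedily: in expectation, one more sample multiplies the potential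
  \<open>\<Sum>j\<in>J. exp (r * \<Sum>l<t. Z j (rs l))\<close> by at most \<open>exp (r\<^sup>2)\<close>.
\<close>

lemma exists_sample_small_potential:
  fixes Z :: "'j \<Rightarrow> 'r \<Rightarrow> real"
  assumes J: "finite J" and Z: "\<And>j x. j \<in> J \<Longrightarrow> \<bar>Z j x\<bar> \<le> 1"
    and mean: "\<And>j. j \<in> J \<Longrightarrow> measure_pmf.expectation R (Z j) = 0"
    and r: "0 \<le> r" "r \<le> 1"
  shows "\<exists>rs :: nat \<Rightarrow> 'r. (\<forall>l<t. rs l \<in> set_pmf R) \<and>
           (\<Sum>j\<in>J. exp (r * (\<Sum>l<t. Z j (rs l)))) \<le> card J * exp (r\<^sup>2 * t)"
proof (induction t)
  case 0
  then show ?case by simp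
next
  case (Suc t)
  then obtain rs where rs: "\<forall>l<t. rs l \<in> set_pmf R"
    and pot: "(\<Sum>j\<in>J. exp (r * (\<Sum>l<t. Z j (rs l)))) \<le> card J * exp (r\<^sup>2 * t)" by blast
  define W where "W j = exp (r * (\<Sum>l<t. Z j (rs l)))" for j
  have rZ: "\<bar>r * Z j x\<bar> \<le> 1" if "j \<in> J" for j x
    unfolding abs_mult using r Z[OF that, of x] by (intro mult_le_one) auto
  have intZ: "integrable (measure_pmf R) (Z j)" if "j \<in> J" for j
    using Z[OF that] by (intro measure_pmf.integrable_const_bound[where B = 1]) auto
  have intE: "integrable (measure_pmf R) (\<lambda>x. exp (r * Z j x))" if "j \<in> J" for j
    using rZ[OF that] by (intro measure_pmf.integrable_const_bound[where B = "exp 1"]) (auto simp: abs_le_iff)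
  have "measure_pmf.expectation R (\<lambda>x. exp (r * Z j x)) \<le> exp (r\<^sup>2)" if j: "j \<in> J" for j
  proof -
    \<comment> \<open>The exponential is replaced by its quadratic bound, because the linear term
      then vanishes in expectation.\<close>
    have "measure_pmf.expectation R (\<lambda>x. exp (r * Z j x)) \<le>
          measure_pmf.expectation R (\<lambda>x. (1 + r\<^sup>2) + r * Z j x)"
    proof (intro integral_mono intE j)
      fix x
      have "exp (r * Z j x) \<le> 1 + r * Z j x + r\<^sup>2 * (Z j x)\<^sup>2"
        using exp_le_one_plus_self_plus_square[OF rZ[OF j]] by (simp add: power_mult_distrib)
      also have "\<dots> \<le> 1 + r * Z j x + r\<^sup>2 * 1"
        using Z[OF j] by (intro add_left_mono mult_left_mono) (auto simp: abs_square_le_1)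
      finally show "exp (r * Z j x) \<le> (1 + r\<^sup>2) + r * Z j x" by simp
    qed (use intZ[OF j] in auto)
    also have "\<dots> = 1 + r\<^sup>2"
      using intZ[OF j] mean[OF j] by simp
    also have "\<dots> \<le> exp (r\<^sup>2)" by (rule exp_ge_add_one_self)
    finally show ?thesis .
  qed
  then have "measure_pmf.expectation R (\<lambda>x. \<Sum>j\<in>J. W j * exp (r * Z j x)) \<le> (\<Sum>j\<in>J. W j * exp (r\<^sup>2))"
    using intE by (simp add: W_def sum_mono)
  also have "\<dots> \<le> card J * exp (r\<^sup>2 * t) * exp (r\<^sup>2)"
    using pot by (simp add: W_def flip: sum_distrib_right)
  also have "\<dots> = card J * exp (r\<^sup>2 * Suc t)"
    by (simp add: algebra_simps flip: exp_add)
  finally obtain x where x: "x \<in> set_pmf R" "(\<Sum>j\<in>J. W j * exp (r * Z j x)) \<le> card J * exp (r\<^sup>2 * Suc t)"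
    using intE by (elim pmf_exists_le_expectation[rotated]) auto
  have "(\<Sum>l<Suc t. Z j ((rs(t := x)) l)) = (\<Sum>l<t. Z j (rs l)) + Z j x" for j
    by simp
  then have "(\<Sum>j\<in>J. exp (r * (\<Sum>l<Suc t. Z j ((rs(t := x)) l)))) = (\<Sum>j\<in>J. W j * exp (r * Z j x))"
    by (simp only: W_def distrib_left exp_add)
  with x rs show ?case
    by (intro exI[of _ "rs(t := x)"]) (auto simp: less_Suc_eq)
qed

text \<open>A union bound in potential form: every summand is at most the whole potential, and
  taking logarithms bounds each deviation. With rate \<open>\<delta> / 2\<close>, the hypothesis on
  \<open>t\<close> lets the number of summands be absorbed by a second factor
  \<open>exp (\<delta>\<^sup>2 * t / 4)\<close>.\<close>

lemma exists_sample_approximating_expectations: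
  fixes g :: "'i \<Rightarrow> 'r \<Rightarrow> real"
  assumes I: "finite I" and g: "\<And>i x. i \<in> I \<Longrightarrow> 0 \<le> g i x \<and> g i x \<le> 1"
    and \<delta>: "0 < \<delta>" "\<delta> \<le> 1" and t: "2 * card I \<le> exp (\<delta>\<^sup>2 * t / 4)"
  shows "\<exists>rs :: nat \<Rightarrow> 'r. (\<forall>l<t. rs l \<in> set_pmf R) \<and>
           (\<forall>i\<in>I. \<bar>(\<Sum>l<t. g i (rs l)) - t * measure_pmf.expectation R (g i)\<bar> \<le> t * \<delta>)"
proof -
  define \<mu> where "\<mu> i = measure_pmf.expectation R (g i)" for i
  \<comment> \<open>Each deviation enters with both signs, so that one-sided bounds yield the
    absolute value. This accounts for the factor 2 in front of \<open>card I\<close>.\<close>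
  define Z where "Z = (\<lambda>(i, b) x. (if b then 1 else - 1) * (g i x - \<mu> i))"
  have intg: "integrable (measure_pmf R) (g i)" if "i \<in> I" for i
    using g[OF that] by (intro measure_pmf.integrable_const_bound[where B = 1]) auto
  have \<mu>: "0 \<le> \<mu> i" "\<mu> i \<le> 1" if "i \<in> I" for i
    unfolding \<mu>_def using g[OF that] intg[OF that]
    by (auto intro!: integral_nonneg_AE measure_pmf.integral_le_const)
  have "\<bar>Z j x\<bar> \<le> 1" if "j \<in> I \<times> UNIV" for j x
    using that \<mu>[of "fst j"] g[of "fst j" x] by (auto simp: Z_def abs_mult split: prod.splits)
  moreover have "measure_pmf.expectation R (Z j) = 0" if "j \<in> I \<times> UNIV" for j
    using that intg[of "fst j"] by (auto simp: Z_def \<mu>_def split: prod.splits)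
  ultimately obtain rs where rs: "\<forall>l<t. rs l \<in> set_pmf R"
    and pot: "(\<Sum>j\<in>I \<times> (UNIV :: bool set). exp (\<delta> / 2 * (\<Sum>l<t. Z j (rs l))))
              \<le> card (I \<times> (UNIV :: bool set)) * exp ((\<delta> / 2)\<^sup>2 * t)"
    using exists_sample_small_potential[of "I \<times> UNIV" Z R "\<delta> / 2" t] I \<delta> by auto
  have bound: "(\<Sum>l<t. Z (i, b) (rs l)) \<le> t * \<delta>" if "i \<in> I" for i b
  proof -
    have "exp (\<delta> / 2 * (\<Sum>l<t. Z (i, b) (rs l))) \<le>
          (\<Sum>j\<in>I \<times> (UNIV :: bool set). exp (\<delta> / 2 * (\<Sum>l<t. Z j (rs l))))"
      using that I by (intro member_le_sum) auto
    also have "\<dots> \<le> exp (\<delta>\<^sup>2 * t / 4) * exp ((\<delta> / 2)\<^sup>2 * t)"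
      using t by (intro order.trans[OF pot] mult_right_mono) (auto simp: card_cartesian_product)
    also have "\<dots> = exp (\<delta> / 2 * (t * \<delta>))"
      by (simp add: power2_eq_square flip: exp_add)
    finally show ?thesis using \<delta> by simp
  qed
  have "\<bar>(\<Sum>l<t. g i (rs l)) - t * \<mu> i\<bar> \<le> t * \<delta>" if "i \<in> I" for i
    using bound[OF that, of True] bound[OF that, of False]
    by (simp add: Z_def sum_subtractf sum_negf abs_le_iff)
  with rs show ?thesis unfolding \<mu>_def by blast
qed

section \<open>Repeated swap tests\<close>

text \<open>
  Measuring with the vectors \<open>swap_vec ((p, q), b)\<close>, for all \<open>p\<close>, \<open>q\<close>, is the swap test with outcome \<open>b\<close>:
  these vectors are the rows of the projection onto the symmetric (\<open>b\<close>) or the antisymmetric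
  (\<open>\<not> b\<close>) subspace, so \<open>b\<close> has probability \<open>(1 \<plusminus> \<langle>u, w\<rangle>\<^sup>2) / 2\<close>.
\<close>

definition outcome_sign :: "bool \<Rightarrow> real" where
  "outcome_sign b = (if b then 1 else - 1)"

definition swap_vec :: "('a \<times> 'a) \<times> bool \<Rightarrow> 'a \<Rightarrow> 'a \<Rightarrow> real" where
  "swap_vec s i j =
     (of_bool (s = ((i, j), snd s)) + outcome_sign (snd s) * of_bool (s = ((j, i), snd s))) / 2"

lemma sum_sum_of_bool_Pair:
  fixes F :: "'a \<Rightarrow> 'b \<Rightarrow> real"
  assumes "finite X" "finite Y" "i \<in> X" "j \<in> Y"
  shows "(\<Sum>p\<in>X. \<Sum>q\<in>Y. of_bool (p = i \<and> q = j) * F p q) = F i j"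
proof -
  have "(\<Sum>q\<in>Y. of_bool (p = i \<and> q = j) * F p q) = (if p = i then F i j else 0)" for p
    using assms by (cases "p = i") (simp_all add: of_bool_def if_distrib[of "\<lambda>x. x * _"] cong: if_cong)
  then show ?thesis using assms by simp
qed

lemma sum_swap_outcomes:
  fixes F :: "('a \<times> 'a) \<times> bool \<Rightarrow> real"
  shows "(\<Sum>s\<in>(X \<times> X) \<times> UNIV. F s) = (\<Sum>p\<in>X. \<Sum>q\<in>X. F ((p, q), True) + F ((p, q), False))"
  by (simp add: sum.cartesian_product' UNIV_bool add.commute)

text \<open>The mixed products of direct and swapped indicators carry the sign of the outcome and
  cancel between the two outcomes. The direct and the swapped products each leave one half.\<close>

lemma swap_vec_parseval:
  assumes X: "finite X" and mem: "i \<in> X" "i' \<in> X" "j \<in> X" "j' \<in> X"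
  shows "(\<Sum>s\<in>(X \<times> X) \<times> UNIV. swap_vec s i j * swap_vec s i' j') = of_bool (i = i' \<and> j = j')"
proof -
  have "(\<Sum>s\<in>(X \<times> X) \<times> UNIV. swap_vec s i j * swap_vec s i' j') =
     (\<Sum>p\<in>X. \<Sum>q\<in>X. of_bool (p = i \<and> q = j) * (of_bool (p = i' \<and> q = j') / 2)
                    + of_bool (p = j \<and> q = i) * (of_bool (p = j' \<and> q = i') / 2))"
    unfolding sum_swap_outcomes
    by (intro sum.cong refl) (simp add: swap_vec_def outcome_sign_def field_simps)
  also have "\<dots> = of_bool (i = i' \<and> j = j')"
    unfolding sum.distrib using X mem by (simp only: sum_sum_of_bool_Pair) (simp add: conj_commute)
  finally show ?thesis .
qed

lemma swap_vec_amplitude: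
  assumes X: "finite X" and mem: "p \<in> X" "q \<in> X"
  shows "(\<Sum>i\<in>X. \<Sum>j\<in>X. swap_vec ((p, q), b) i j * (u i * w j)) =
         (u p * w q + outcome_sign b * (u q * w p)) / 2"
proof -
  have "(\<Sum>i\<in>X. \<Sum>j\<in>X. swap_vec ((p, q), b) i j * (u i * w j)) =
     (\<Sum>i\<in>X. \<Sum>j\<in>X. of_bool (i = p \<and> j = q) * (u i * w j / 2)
                    + of_bool (i = q \<and> j = p) * (outcome_sign b * (u i * w j) / 2))"
    by (intro sum.cong refl) (auto simp: swap_vec_def field_simps)
  also have "\<dots> = (u p * w q + outcome_sign b * (u q * w p)) / 2"
    unfolding sum.distrib using X mem
    by (simp only: sum_sum_of_bool_Pair) (simp add: add_divide_distrib)
  finally show ?thesis .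
qed

definition swap_prob :: "'a set \<Rightarrow> ('a \<Rightarrow> real) \<Rightarrow> ('a \<Rightarrow> real) \<Rightarrow> ('a \<times> 'a) \<times> bool \<Rightarrow> real" where
  "swap_prob X u w s = (\<Sum>i\<in>X. \<Sum>j\<in>X. swap_vec s i j * (u i * w j))\<^sup>2"

text \<open>Adding the two outcomes keeps the squares of \<open>u p * w q\<close> and
  \<open>u q * w p\<close>; subtracting them keeps only the mixed term, which regroups as
  \<open>(u p * w p) * (u q * w q)\<close>. Hence the signed outcome is an unbiased estimate of the
  squared inner product.\<close>

lemma sum_swap_prob:
  assumes X: "finite X" and u: "(\<Sum>i\<in>X. (u i)\<^sup>2) = 1" and w: "(\<Sum>i\<in>X. (w i)\<^sup>2) = 1"
  shows "(\<Sum>s\<in>(X \<times> X) \<times> UNIV. swap_prob X u w s) = 1"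
    and "(\<Sum>s\<in>(X \<times> X) \<times> UNIV. swap_prob X u w s * outcome_sign (snd s)) = (\<Sum>i\<in>X. u i * w i)\<^sup>2"
proof -
  have prob: "swap_prob X u w ((p, q), b) = ((u p * w q + outcome_sign b * (u q * w p)) / 2)\<^sup>2"
    if "p \<in> X" "q \<in> X" for p q b
    using that X by (simp only: swap_prob_def swap_vec_amplitude)
  have uw: "(\<Sum>p\<in>X. \<Sum>q\<in>X. (u p)\<^sup>2 * (w q)\<^sup>2) = 1"
    unfolding sum_product[symmetric] u w by simp
  then have wu: "(\<Sum>p\<in>X. \<Sum>q\<in>X. (u q)\<^sup>2 * (w p)\<^sup>2) = 1"
    by (subst sum.swap)
  have "(\<Sum>s\<in>(X \<times> X) \<times> UNIV. swap_prob X u w s) =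
        (\<Sum>p\<in>X. \<Sum>q\<in>X. ((u p)\<^sup>2 * (w q)\<^sup>2) / 2 + ((u q)\<^sup>2 * (w p)\<^sup>2) / 2)"
    unfolding sum_swap_outcomes
    by (intro sum.cong refl) (simp add: prob outcome_sign_def power2_eq_square field_simps)
  then show "(\<Sum>s\<in>(X \<times> X) \<times> UNIV. swap_prob X u w s) = 1"
    by (simp add: sum.distrib uw wu flip: sum_divide_distrib)
  have "(\<Sum>s\<in>(X \<times> X) \<times> UNIV. swap_prob X u w s * outcome_sign (snd s)) =
        (\<Sum>p\<in>X. \<Sum>q\<in>X. (u p * w p) * (u q * w q))"
    unfolding sum_swap_outcomes
    by (intro sum.cong refl) (simp add: prob outcome_sign_def power2_eq_square field_simps)
  then show "(\<Sum>s\<in>(X \<times> X) \<times> UNIV. swap_prob X u w s * outcome_sign (snd s)) = (\<Sum>i\<in>X. u i * w i)\<^sup>2"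
    by (simp add: power2_eq_square sum_product)
qed

lemma prod_of_bool_PiE_eq:
  assumes "finite I" "g \<in> Pi\<^sub>E I B" "g' \<in> Pi\<^sub>E I B" "h \<in> Pi\<^sub>E I B" "h' \<in> Pi\<^sub>E I B"
  shows "(\<Prod>l\<in>I. of_bool (g l = g' l \<and> h l = h' l)) = (of_bool (g = g' \<and> h = h') :: real)"
proof (cases "g = g' \<and> h = h'")
  case False
  then obtain l where "l \<in> I" "\<not> (g l = g' l \<and> h l = h' l)"
    using assms by (metis PiE_ext)
  then have "(\<Prod>l\<in>I. of_bool (g l = g' l \<and> h l = h' l)) = (0 :: real)"
    using assms by (intro prod_zero) auto
  with False show ?thesis by simp
qed simp

text \<open>Each party sends \<open>k\<close> copies of a \<open>q\<close>-qubit state, and the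
  \<open>l\<close>-th copies are swap-tested against each other. States and measurement vectors are
  products over \<open>l\<close>, so the outcomes are independent and the Chernoff bound applies to
  their shifted signs.\<close>

lemma quantum_SMP_protocol_of_inner_products:
  fixes u w :: "bool list \<Rightarrow> 'a \<Rightarrow> real"
  assumes X: "card X = 2 ^ q"
    and u: "\<And>x. x \<in> bitstrings n \<Longrightarrow> (\<Sum>i\<in>X. (u x i)\<^sup>2) = 1"
    and w: "\<And>y. y \<in> bitstrings n \<Longrightarrow> (\<Sum>i\<in>X. (w y i)\<^sup>2) = 1"
    and \<theta>: "0 \<le> \<theta>" "\<theta> \<le> 1" and d: "0 \<le> d" "d \<le> 1"
    and true: "\<And>x y. x \<in> bitstrings n \<Longrightarrow> y \<in> bitstrings n \<Longrightarrow> f x y \<Longrightarrow>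
        \<theta> + 2 * d \<le> (\<Sum>i\<in>X. u x i * w y i)\<^sup>2"
    and false: "\<And>x y. x \<in> bitstrings n \<Longrightarrow> y \<in> bitstrings n \<Longrightarrow> \<not> f x y \<Longrightarrow>
        (\<Sum>i\<in>X. u x i * w y i)\<^sup>2 \<le> \<theta> - 2 * d"
    and k: "exp (- (d\<^sup>2 * k / 4)) \<le> \<epsilon>"
  shows "has_quantum_SMP_protocol n f \<epsilon> (q * k) (q * k)"
proof (rule quantum_SMP_protocol_of_amplitudes)
  let ?A = "{..<k} \<rightarrow>\<^sub>E X" and ?T = "(X \<times> X) \<times> (UNIV :: bool set)"
  let ?S = "{..<k} \<rightarrow>\<^sub>E ?T"
  have finX: "finite X" using X by (auto intro: card_ge_0_finite)
  then have finT: "finite ?T" by simp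
  \<comment> \<open>Halving keeps every term in \<open>[-1, 1]\<close>, as the Chernoff bound
    demands, and turns the gap \<open>2 * d\<close> into a drift of \<open>d\<close>. A tie counts
    as rejection.\<close>
  define acc where "acc s \<longleftrightarrow> 0 < (\<Sum>l<k. (outcome_sign (snd (s l)) - \<theta>) / 2)"
    for s :: "nat \<Rightarrow> ('a \<times> 'a) \<times> bool"
  show "card ?A = 2 ^ (q * k)" "card ?A = 2 ^ (q * k)"
    by (simp_all add: card_funcsetE X power_mult)
  show "finite ?S" using finT by (intro finite_PiE) auto
  show "(\<Sum>s\<in>?S. (\<Prod>l<k. swap_vec (s l) (i l) (j l)) * (\<Prod>l<k. swap_vec (s l) (i' l) (j' l)))
        = of_bool (i = i' \<and> j = j')"
    if mem: "i \<in> ?A" "i' \<in> ?A" "j \<in> ?A" "j' \<in> ?A" for i i' j j'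
  proof -
    have "(\<Sum>s\<in>?S. (\<Prod>l<k. swap_vec (s l) (i l) (j l)) * (\<Prod>l<k. swap_vec (s l) (i' l) (j' l)))
        = (\<Prod>l<k. \<Sum>s\<in>?T. swap_vec s (i l) (j l) * swap_vec s (i' l) (j' l))"
      using finT by (simp add: prod_sum_PiE prod.distrib)
    also have "\<dots> = (\<Prod>l<k. of_bool (i l = i' l \<and> j l = j' l))"
      using mem by (intro prod.cong refl swap_vec_parseval finX) auto
    also have "\<dots> = of_bool (i = i' \<and> j = j')"
      using mem by (intro prod_of_bool_PiE_eq) auto
    finally show ?thesis .
  qed
  have unit: "(\<Sum>i\<in>?A. (\<Prod>l<k. v (i l))\<^sup>2) = 1" if "(\<Sum>i\<in>X. (v i)\<^sup>2) = 1" for v :: "'a \<Rightarrow> real"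
  proof -
    have "(\<Sum>i\<in>?A. (\<Prod>l<k. v (i l))\<^sup>2) = (\<Prod>l<k. \<Sum>i\<in>X. (v i)\<^sup>2)"
      using finX by (subst prod_sum_PiE) (auto simp: prod_power_distrib)
    with that show ?thesis by simp
  qed
  show "(\<Sum>i\<in>?A. (\<Prod>l<k. u x (i l))\<^sup>2) = 1" if "x \<in> bitstrings n" for x
    using unit u[OF that] by blast
  show "(\<Sum>i\<in>?A. (\<Prod>l<k. w y (i l))\<^sup>2) = 1" if "y \<in> bitstrings n" for y
    using unit w[OF that] by blast
  show "(\<Sum>s | s \<in> ?S \<and> acc s \<noteq> f x y.
     (\<Sum>i\<in>?A. \<Sum>j\<in>?A. (\<Prod>l<k. swap_vec (s l) (i l) (j l)) * ((\<Prod>l<k. u x (i l)) * (\<Prod>l<k. w y (j l))))\<^sup>2) \<le> \<epsilon>"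
    if x: "x \<in> bitstrings n" and y: "y \<in> bitstrings n" for x y
  proof -
    let ?P = "swap_prob X (u x) (w y)"
    have amp: "(\<Sum>i\<in>?A. \<Sum>j\<in>?A. (\<Prod>l<k. swap_vec (s l) (i l) (j l)) * ((\<Prod>l<k. u x (i l)) * (\<Prod>l<k. w y (j l))))\<^sup>2
          = (\<Prod>l<k. ?P (s l))" for s
    proof -
      have "(\<Sum>i\<in>?A. \<Sum>j\<in>?A. (\<Prod>l<k. swap_vec (s l) (i l) (j l)) * ((\<Prod>l<k. u x (i l)) * (\<Prod>l<k. w y (j l))))
          = (\<Sum>i\<in>?A. \<Sum>j\<in>?A. \<Prod>l<k. swap_vec (s l) (i l) (j l) * (u x (i l) * w y (j l)))"
        by (simp add: prod.distrib)
      also have "\<dots> = (\<Sum>i\<in>?A. \<Prod>l<k. \<Sum>j\<in>X. swap_vec (s l) (i l) j * (u x (i l) * w y j))"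
        using finX by (simp add: prod_sum_PiE)
      also have "\<dots> = (\<Prod>l<k. \<Sum>i\<in>X. \<Sum>j\<in>X. swap_vec (s l) i j * (u x i * w y j))"
        using finX by (simp add: prod_sum_PiE)
      finally show ?thesis by (simp add: swap_prob_def prod_power_distrib)
    qed
    note P = sum_swap_prob[OF finX u[OF x] w[OF y]]
    have tail: "(\<Sum>s | s \<in> ?S \<and> 0 \<le> (\<Sum>l<k. Y (s l)). \<Prod>l<k. ?P (s l)) \<le> \<epsilon>"
      if "\<And>s. \<bar>Y s\<bar> \<le> 1" "(\<Sum>s\<in>?T. ?P s * Y s) \<le> - d" for Y
      using that finT d P(1) by (intro order.trans[OF product_Chernoff_bound k]) (auto simp: swap_prob_def)
    have nonneg: "0 \<le> (\<Prod>l<k. ?P (s l))" for s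
      by (intro prod_nonneg) (simp add: swap_prob_def)
    have bound: "\<bar>(outcome_sign b - \<theta>) / 2\<bar> \<le> 1" for b
      using \<theta> by (auto simp: outcome_sign_def)
    have mean: "(\<Sum>s\<in>?T. ?P s * ((outcome_sign (snd s) - \<theta>) / 2)) = ((\<Sum>i\<in>X. u x i * w y i)\<^sup>2 - \<theta>) / 2"
      using P by (simp add: right_diff_distrib sum_subtractf flip: sum_divide_distrib sum_distrib_right)
    show ?thesis
    proof (cases "f x y")
      case True
      have "(\<Sum>s | s \<in> ?S \<and> acc s \<noteq> f x y. \<Prod>l<k. ?P (s l))
            = (\<Sum>s | s \<in> ?S \<and> 0 \<le> (\<Sum>l<k. - ((outcome_sign (snd (s l)) - \<theta>) / 2)). \<Prod>l<k. ?P (s l))"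
        using True by (simp only: acc_def sum_negf neg_0_le_iff_le not_less simp_thms)
      also have "\<dots> \<le> \<epsilon>"
      proof (rule tail)
        show "\<bar>- ((outcome_sign (snd s) - \<theta>) / 2)\<bar> \<le> 1" for s :: "('a \<times> 'a) \<times> bool"
          using bound by (simp only: abs_minus_cancel)
        show "(\<Sum>s\<in>?T. ?P s * - ((outcome_sign (snd s) - \<theta>) / 2)) \<le> - d"
          using true[OF x y True] mean by (simp add: sum_negf)
      qed
      finally show ?thesis by (simp add: amp)
    next
      case False
      have "(\<Sum>s | s \<in> ?S \<and> acc s \<noteq> f x y. \<Prod>l<k. ?P (s l))
            \<le> (\<Sum>s | s \<in> ?S \<and> 0 \<le> (\<Sum>l<k. (outcome_sign (snd (s l)) - \<theta>) / 2). \<Prod>l<k. ?P (s l))"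
        using False \<open>finite ?S\<close> nonneg by (intro sum_mono2) (auto simp: acc_def)
      also have "\<dots> \<le> \<epsilon>"
      proof (rule tail)
        show "\<bar>(outcome_sign (snd s) - \<theta>) / 2\<bar> \<le> 1" for s :: "('a \<times> 'a) \<times> bool"
          by (rule bound)
        show "(\<Sum>s\<in>?T. ?P s * ((outcome_sign (snd s) - \<theta>) / 2)) \<le> - d"
          using false[OF x y False] mean by simp
      qed
      finally show ?thesis by (simp add: amp)
    qed
  qed
qed

section \<open>From public coins to inner products\<close>

lemma card_bitstrings: "card (bitstrings n) = 2 ^ n"
  using card_lists_length_eq[of "UNIV :: bool set" n] by (simp add: bitstrings_def)

lemma finite_bitstrings: "finite (bitstrings n)"
  using card_bitstrings[of n] by (auto intro: card_ge_0_finite)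

lemma pmf_False_eq: "pmf p False = 1 - pmf p True"
proof -
  have "(\<Sum>b\<in>UNIV. pmf p b) = 1" by (rule sum_pmf_eq_1) auto
  then show ?thesis by (simp add: UNIV_bool)
qed

text \<open>
  Bob's registers carry \<open>M s (b r y)\<close> on every possible message \<open>s\<close> of Alice, in superposition with
  the matching normalisation \<open>sqrt (1 - M\<^sup>2)\<close> in an orthogonal flag state, so that the inner product
  with Alice's state averages \<open>M (a r x) (b r y)\<close> over \<open>r\<close>, scaled by \<open>1 / sqrt (2 ^ c)\<close>.
\<close>

definition alice_amp :: "nat \<Rightarrow> (nat \<Rightarrow> bool list) \<Rightarrow> nat \<times> bool list \<times> bool \<Rightarrow> real" where
  "alice_amp t a = (\<lambda>(r, s, b). of_bool (s = a r \<and> \<not> b) / sqrt t)"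

definition bob_amp :: "nat \<Rightarrow> nat \<Rightarrow> (nat \<Rightarrow> bool list \<Rightarrow> real) \<Rightarrow> nat \<times> bool list \<times> bool \<Rightarrow> real" where
  "bob_amp t c m = (\<lambda>(r, s, b). (if b then sqrt (1 - (m r s)\<^sup>2) else m r s) / sqrt (t * 2 ^ c))"

lemma sum_message_register:
  fixes F :: "'a \<times> 'b \<times> bool \<Rightarrow> real"
  shows "(\<Sum>i\<in>X \<times> Y \<times> UNIV. F i) = (\<Sum>r\<in>X. \<Sum>s\<in>Y. F (r, s, True) + F (r, s, False))"
  by (simp add: sum.cartesian_product' UNIV_bool add.commute)

lemma alice_amp_norm:
  assumes "0 < t" and a: "\<And>r. r < t \<Longrightarrow> a r \<in> bitstrings c"
  shows "(\<Sum>i\<in>{..<t} \<times> bitstrings c \<times> UNIV. (alice_amp t a i)\<^sup>2) = 1"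
proof -
  have "(\<Sum>i\<in>{..<t} \<times> bitstrings c \<times> UNIV. (alice_amp t a i)\<^sup>2)
        = (\<Sum>r<t. \<Sum>s\<in>bitstrings c. if s = a r then 1 / real t else 0)"
    unfolding sum_message_register
    by (intro sum.cong refl) (simp add: alice_amp_def power_divide)
  also have "\<dots> = 1" using assms finite_bitstrings by simp
  finally show ?thesis .
qed

lemma bob_amp_norm:
  assumes "0 < t" and m: "\<And>r s. 0 \<le> m r s \<and> m r s \<le> 1"
  shows "(\<Sum>i\<in>{..<t} \<times> bitstrings c \<times> UNIV. (bob_amp t c m i)\<^sup>2) = 1"
proof -
  have "(m r s)\<^sup>2 \<le> 1" for r s using m[of r s] by (simp add: power_le_one)
  then have "(\<Sum>i\<in>{..<t} \<times> bitstrings c \<times> UNIV. (bob_amp t c m i)\<^sup>2)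
        = (\<Sum>r<t. \<Sum>s\<in>bitstrings c. 1 / (real t * 2 ^ c))"
    unfolding sum_message_register
    by (intro sum.cong refl) (simp add: bob_amp_def power_divide flip: add_divide_distrib)
  also have "\<dots> = 1" using assms by (simp add: card_bitstrings)
  finally show ?thesis .
qed

text \<open>Alice's amplitudes live on \<open>s = a r\<close> with the flag off, so for each
  \<open>r\<close> exactly one of Bob's entries is seen and his normalising flag part never
  is.\<close>

lemma alice_bob_inner_product:
  assumes "0 < t" and a: "\<And>r. r < t \<Longrightarrow> a r \<in> bitstrings c"
  shows "(\<Sum>i\<in>{..<t} \<times> bitstrings c \<times> UNIV. alice_amp t a i * bob_amp t c m i)
         = (\<Sum>r<t. m r (a r)) / (t * sqrt (2 ^ c))"
proof -
  have "(\<Sum>i\<in>{..<t} \<times> bitstrings c \<times> UNIV. alice_amp t a i * bob_amp t c m i)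
        = (\<Sum>r<t. \<Sum>s\<in>bitstrings c. if s = a r then m r s / (t * sqrt (2 ^ c)) else 0)"
    unfolding sum_message_register
    by (intro sum.cong refl) (simp add: alice_amp_def bob_amp_def real_sqrt_mult flip: mult.assoc)
  also have "\<dots> = (\<Sum>r<t. m r (a r)) / (t * sqrt (2 ^ c))"
    using assms finite_bitstrings by (simp add: sum_divide_distrib)
  finally show ?thesis .
qed

text \<open>One sample must serve all \<open>4 ^ n\<close> input pairs at once. An accuracy of
  \<open>1/12\<close> moves the acceptance bounds \<open>2/3\<close> and \<open>1/3\<close> to
  \<open>7/12\<close> and \<open>5/12\<close>, which are still separated.\<close>

lemma public_coin_finite_average:
  assumes n: "n \<ge> 1" and t: "2048 * n \<le> t" and f: "has_public_coin_SMP_protocol n f (1/3) c"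
  obtains a M b where
    "\<And>r x. r < t \<Longrightarrow> x \<in> bitstrings n \<Longrightarrow> a r x \<in> bitstrings c"
    "\<And>s s' :: bool list. 0 \<le> M s s' \<and> M s s' \<le> 1"
    "\<And>x y. x \<in> bitstrings n \<Longrightarrow> y \<in> bitstrings n \<Longrightarrow> f x y \<Longrightarrow>
       7 / 12 \<le> (\<Sum>r<t. M (a r x) (b r y)) / t"
    "\<And>x y. x \<in> bitstrings n \<Longrightarrow> y \<in> bitstrings n \<Longrightarrow> \<not> f x y \<Longrightarrow>
       (\<Sum>r<t. M (a r x) (b r y)) / t \<le> 5 / 12"
proof -
  obtain R alice bob referee where
    alice: "\<forall>r \<in> set_pmf R. \<forall>x \<in> bitstrings n. alice r x \<in> bitstrings c" and
    err: "\<forall>x \<in> bitstrings n. \<forall>y \<in> bitstrings n.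
           measure_pmf.prob (public_coin_output R alice bob referee x y) {z. z \<noteq> f x y} \<le> 1/3"
    using f unfolding has_public_coin_SMP_protocol_def by blast
  define M where "M s s' = pmf (referee s s') True" for s s'
  define g where "g = (\<lambda>(x, y) r. M (alice r x) (bob r y))"
  define \<mu> where "\<mu> x y = measure_pmf.expectation R (g (x, y))" for x y
  have \<mu>: "\<mu> x y = pmf (public_coin_output R alice bob referee x y) True" for x y
    by (simp add: \<mu>_def g_def M_def public_coin_output_def pmf_bind)
  have \<mu>_true: "2 / 3 \<le> \<mu> x y" if "x \<in> bitstrings n" "y \<in> bitstrings n" "f x y" for x y
  proof -
    have "{z. z \<noteq> f x y} = {False}" using that by auto
    with err that have "pmf (public_coin_output R alice bob referee x y) False \<le> 1 / 3"
      by (metis measure_pmf_single)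
    then show ?thesis by (simp add: \<mu> pmf_False_eq)
  qed
  have \<mu>_false: "\<mu> x y \<le> 1 / 3" if "x \<in> bitstrings n" "y \<in> bitstrings n" "\<not> f x y" for x y
  proof -
    have "{z. z \<noteq> f x y} = {True}" using that by auto
    with err that show ?thesis unfolding \<mu> by (metis measure_pmf_single)
  qed
  let ?I = "bitstrings n \<times> bitstrings n"
  \<comment> \<open>The right side is \<open>exp (t / 576)\<close>, and
    \<open>2 * 4 ^ n \<le> 8 ^ n \<le> exp (3 * n)\<close>, so \<open>t \<ge> 1728 * n\<close> is
    enough; 2048 is the next power of two.\<close>
  have size: "2 * real (card ?I) \<le> exp ((1/12)\<^sup>2 * real t / 4)"
  proof -
    have "(2::real) * 4 ^ n \<le> 2 ^ n * 4 ^ n"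
      using n self_le_power[of "2::real" n] by (intro mult_right_mono) auto
    also have "\<dots> = (2 ^ 3) ^ n" by (simp flip: power_mult_distrib)
    also have "\<dots> \<le> ((exp 1) ^ 3) ^ n"
      using exp_ge_add_one_self[of "1::real"] by (intro power_mono) auto
    also have "\<dots> = exp (real (3 * n))" by (simp flip: exp_of_nat_mult power_mult)
    also have "\<dots> \<le> exp ((1/12)\<^sup>2 * real t / 4)"
      using t by (simp add: power2_eq_square)
    finally show ?thesis
      by (simp add: card_cartesian_product card_bitstrings flip: power_mult_distrib)
  qed
  have "0 \<le> g i x \<and> g i x \<le> 1" for i x
    by (cases i) (simp add: g_def M_def pmf_le_1)
  then obtain rs where rs: "\<forall>l<t. rs l \<in> set_pmf R"
    and approx: "\<forall>i\<in>?I. \<bar>(\<Sum>l<t. g i (rs l)) - t * measure_pmf.expectation R (g i)\<bar> \<le> t * (1 / 12)"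
    using exists_sample_approximating_expectations[of ?I g "1/12" t R] size finite_bitstrings by auto
  have t0: "0 < real t" using n t by simp
  have close: "\<bar>(\<Sum>l<t. M (alice (rs l) x) (bob (rs l) y)) / t - \<mu> x y\<bar> \<le> 1 / 12"
    if "x \<in> bitstrings n" "y \<in> bitstrings n" for x y
  proof -
    have "\<bar>(\<Sum>l<t. M (alice (rs l) x) (bob (rs l) y)) - t * \<mu> x y\<bar> \<le> t * (1 / 12)"
      using bspec[OF approx, of "(x, y)"] that by (simp add: \<mu>_def g_def)
    then have "\<bar>((\<Sum>l<t. M (alice (rs l) x) (bob (rs l) y)) - t * \<mu> x y) / t\<bar> \<le> 1 / 12"
      using t0 by (simp add: field_simps)
    then show ?thesis using t0 by (simp add: diff_divide_distrib)
  qed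
  show thesis
  proof (rule that[of "\<lambda>l. alice (rs l)" M "\<lambda>l. bob (rs l)"])
    show "7 / 12 \<le> (\<Sum>l<t. M (alice (rs l) x) (bob (rs l) y)) / t"
      if "x \<in> bitstrings n" "y \<in> bitstrings n" "f x y" for x y
      using close[OF that(1,2)] \<mu>_true[OF that] by linarith
    show "(\<Sum>l<t. M (alice (rs l) x) (bob (rs l) y)) / t \<le> 5 / 12"
      if "x \<in> bitstrings n" "y \<in> bitstrings n" "\<not> f x y" for x y
      using close[OF that(1,2)] \<mu>_false[OF that] by linarith
  qed (use rs alice in \<open>auto simp: M_def pmf_le_1\<close>)
qed

text \<open>One copy takes \<open>m\<close> qubits for the sample index, \<open>c\<close> for the
  message and one for the flag; the remaining factor of \<open>N\<close> is the number of
  copies.\<close>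

lemma quantum_SMP_protocol_of_public_coin:
  assumes n: "n \<ge> 1" and m: "2048 * n \<le> 2 ^ m" and f: "has_public_coin_SMP_protocol n f (1/3) c"
  defines "N \<equiv> (m + c + 1) * (4608 * 4 ^ c)"
  shows "has_quantum_SMP_protocol n f (1/3) N N"
proof -
  obtain a M b where
    a: "\<And>(r::nat) x. r < 2 ^ m \<Longrightarrow> x \<in> bitstrings n \<Longrightarrow> a r x \<in> bitstrings c" and
    M: "\<And>s s' :: bool list. 0 \<le> M s s' \<and> M s s' \<le> 1" and
    true: "\<And>x y. x \<in> bitstrings n \<Longrightarrow> y \<in> bitstrings n \<Longrightarrow> f x y \<Longrightarrow>
       7 / 12 \<le> (\<Sum>r<2 ^ m. M (a r x) (b r y)) / real (2 ^ m)" and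
    false: "\<And>x y. x \<in> bitstrings n \<Longrightarrow> y \<in> bitstrings n \<Longrightarrow> \<not> f x y \<Longrightarrow>
       (\<Sum>r<2 ^ m. M (a r x) (b r y)) / real (2 ^ m) \<le> 5 / 12"
    by (rule public_coin_finite_average[OF n m f]) (rule that; assumption)
  let ?t = "2 ^ m :: nat"
  let ?X = "{..<?t} \<times> bitstrings c \<times> (UNIV :: bool set)"
  let ?u = "\<lambda>x. alice_amp ?t (\<lambda>r. a r x)" and ?w = "\<lambda>y. bob_amp ?t c (\<lambda>r s. M s (b r y))"
  have inner: "(\<Sum>i\<in>?X. ?u x i * ?w y i)\<^sup>2 = ((\<Sum>r<?t. M (a r x) (b r y)) / real ?t)\<^sup>2 / 2 ^ c"
    if "x \<in> bitstrings n" for x y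
    using a that by (subst alice_bob_inner_product) (auto simp: power_divide power_mult_distrib)
  have scaled_le_1: "z / 2 ^ c \<le> 1" if "z \<le> 1" for z :: real
    using order.trans[OF that one_le_power[of "2 :: real" c]] by simp
  show ?thesis unfolding N_def
  proof (rule quantum_SMP_protocol_of_inner_products)
    show "card ?X = 2 ^ (m + c + 1)"
      by (simp add: card_cartesian_product card_bitstrings power_add)
    show "(\<Sum>i\<in>?X. (?u x i)\<^sup>2) = 1" if "x \<in> bitstrings n" for x
      using a that by (intro alice_amp_norm) auto
    show "(\<Sum>i\<in>?X. (?w y i)\<^sup>2) = 1" for y
      using M by (intro bob_amp_norm) auto
    \<comment> \<open>The squared averages are at least 49/144 or at most 25/144; the threshold is the midpoint.\<close>
    show "0 \<le> 37 / 144 / (2::real) ^ c" "0 \<le> 1 / 24 / (2::real) ^ c" by simp_all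
    show "37 / 144 / (2::real) ^ c \<le> 1" "1 / 24 / (2::real) ^ c \<le> 1"
      by (rule scaled_le_1; simp)+
    show "37 / 144 / 2 ^ c + 2 * (1 / 24 / 2 ^ c) \<le> (\<Sum>i\<in>?X. ?u x i * ?w y i)\<^sup>2"
      if xy: "x \<in> bitstrings n" "y \<in> bitstrings n" "f x y" for x y
    proof -
      have "(7 / 12)\<^sup>2 / 2 ^ c \<le> (\<Sum>i\<in>?X. ?u x i * ?w y i)\<^sup>2"
        unfolding inner[OF xy(1)] using true[OF xy] by (intro divide_right_mono power_mono) auto
      then show ?thesis by (simp add: power2_eq_square field_simps)
    qed
    show "(\<Sum>i\<in>?X. ?u x i * ?w y i)\<^sup>2 \<le> 37 / 144 / 2 ^ c - 2 * (1 / 24 / 2 ^ c)"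
      if xy: "x \<in> bitstrings n" "y \<in> bitstrings n" "\<not> f x y" for x y
    proof -
      \<comment> \<open>Squaring preserves this upper bound because the average of values of
        \<open>M\<close> is nonnegative.\<close>
      have "(\<Sum>i\<in>?X. ?u x i * ?w y i)\<^sup>2 \<le> (5 / 12)\<^sup>2 / 2 ^ c"
        unfolding inner[OF xy(1)] using false[OF xy] M
        by (intro divide_right_mono power_mono divide_nonneg_nonneg sum_nonneg) auto
      then show ?thesis by (simp add: power2_eq_square field_simps)
    qed
    \<comment> \<open>4608 is \<open>2 * 4 * 24\<^sup>2\<close>, chosen to make the Chernoff
      exponent 2, and \<open>exp 2 \<ge> 3\<close> gives the error \<open>1/3\<close>.\<close>
    have exponent: "(1 / 24 / (2::real) ^ c)\<^sup>2 * real (4608 * 4 ^ c) / 4 = 2"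
    proof -
      have "((2::real) ^ c)\<^sup>2 = 4 ^ c" by (simp add: power2_eq_square flip: power_mult_distrib)
      then show ?thesis by (simp add: power_divide)
    qed
    have "exp (- 2 :: real) \<le> 1 / 3"
      using exp_ge_add_one_self[of "2::real"] by (simp add: exp_minus field_simps)
    then show "exp (- ((1 / 24 / 2 ^ c)\<^sup>2 * real (4608 * 4 ^ c) / 4)) \<le> (1 / 3 :: real)"
      unfolding exponent .
  qed
qed

theorem mainTheorem3:
  shows "\<exists>C::real. C > 0 \<and>
    (\<forall>(n::nat) (c::nat) (f :: bool list \<Rightarrow> bool list \<Rightarrow> bool).
       n \<ge> 1 \<longrightarrow> c \<ge> 1 \<longrightarrow> has_public_coin_SMP_protocol n f (1/3) c \<longrightarrow>
       (\<exists>a b. has_quantum_SMP_protocol n f (1/3) a b \<and>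
          real (a + b) \<le> C * 2 ^ (2 * c) * (real c + log 2 (real n))))"
proof (intro exI[of _ "129024::real"] conjI allI impI)
  fix n c :: nat and f :: "bool list \<Rightarrow> bool list \<Rightarrow> bool"
  assume n: "n \<ge> 1" and c: "c \<ge> 1" and f: "has_public_coin_SMP_protocol n f (1/3) c"
  \<comment> \<open>The summand 11 comes from \<open>2048 = 2 ^ 11\<close>.\<close>
  define m where "m = nat \<lceil>log 2 n\<rceil> + 11"
  define N where "N = (m + c + 1) * (4608 * 4 ^ c)"
  have log: "0 \<le> log 2 n" using n by simp
  have "real n = 2 powr log 2 n" using n by simp
  also have "\<dots> \<le> 2 powr nat \<lceil>log 2 n\<rceil>" using log by (intro powr_mono) linarith+
  also have "\<dots> = real (2 ^ nat \<lceil>log 2 n\<rceil>)" by (simp add: powr_realpow)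
  finally have "n \<le> 2 ^ nat \<lceil>log 2 n\<rceil>" by (simp only: of_nat_le_iff)
  then have "2048 * n \<le> 2 ^ m" by (simp add: m_def power_add)
  from quantum_SMP_protocol_of_public_coin[OF n this f]
  have "has_quantum_SMP_protocol n f (1/3) N N" by (simp only: N_def)
  moreover have "real (N + N) \<le> 129024 * 2 ^ (2 * c) * (real c + log 2 n)"
  proof -
    have "real m \<le> log 2 n + 12" using log by (simp add: m_def) linarith
    \<comment> \<open>The additive constant 13 is absorbed by \<open>13 * c\<close>; for
      \<open>n = 1\<close> the logarithm vanishes and only \<open>c \<ge> 1\<close> can pay for it.
      With two parties and 4608 copies per factor \<open>4 ^ c\<close>, the final constant is
      \<open>14 * 9216 = 129024\<close>.\<close>
    then have "real (m + c + 1) \<le> 14 * (real c + log 2 n)" using c log by simp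
    then have "real (m + c + 1) * (9216 * 4 ^ c) \<le> 14 * (real c + log 2 n) * (9216 * 4 ^ c)"
      by (intro mult_right_mono) auto
    moreover have "(2::real) ^ (2 * c) = 4 ^ c" by (simp add: power_mult)
    ultimately show ?thesis by (simp add: N_def algebra_simps)
  qed
  ultimately show "\<exists>a b. has_quantum_SMP_protocol n f (1/3) a b \<and>
      real (a + b) \<le> 129024 * 2 ^ (2 * c) * (real c + log 2 n)"
    by blast
qed simp

end
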